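(* Let $G$ be a type definable group in a dependent theory, and let $\mathfrak{F}$ be a family of uniformly type definable subgroups of $G$ defined by a partial type $p(x,y)$ (i.e. every member of $\mathfrak{F}$ is a subgroup of $G$ of the form $p(\mathfrak{C},c)$). Then for any regular cardinal $\kappa>|p|$ and any subfamily $\mathfrak{G}\subseteq\mathfrak{F}$, there is some $\mathfrak{G}'\subseteq\mathfrak{G}$ such that $|\mathfrak{G}'|<\kappa$ and $\bigcap\mathfrak{G}=\bigcap\mathfrak{G}'\cap\bigcap_{\kappa}\mathfrak{G}$.
   Context: $T$ is a complete first order theory and $\mathfrak{C}$ is its monster model (a very big saturated model containing all small models). Dependent (NIP): $T$ is dependent if no formula $\varphi(x,y)$ has the independence property in a model of $T$, where $\varphi(x,y)$ has the independence property in a model if for every $n<\omega$ there are $\langle a_i,b_s\mid i<n,\ s\subseteq n\rangle$ in it such that $\varphi(a_i,b_s)$ holds iff $i\in s$. Type definable group: given by a partial type $\Sigma(x)$ ($x$ a finite tuple), possibly over a small set of parameters, and a formula $\nu(x,y,z)$ such that $\langle \Sigma(\mathfrak{C}),\nu\rangle$ is a group with $\nu$ defining the (graph of the) group operation. Size of a type: $|p|$ is the size of the set of formulas $\varphi(x,z_1,\ldots,z_n)$ (each $z_i$ a single variable) such that for some finite tuple $y_1,\ldots,y_n$ from $y$, $\varphi(x,y_1,\ldots,y_n)\in p$. $\kappa$-intersection: for a cardinal $\kappa$ and a family $\mathfrak{F}$ of subgroups of a group $G$, $\bigcap_{\kappa}\mathfrak{F}=\{g\in G\mid |\{F\in\mathfrak{F}\mid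 g\notin F\}|<\kappa\}$. Regular cardinals are infinite, and the intersection of an empty family of subgroups of $G$ is $G$. *)

theory Defs
  imports Main "HOL-Algebra.Group"
begin

unbundle cardinal_syntax

text \<open>
  The types \<open>'f\<close> and \<open>'r\<close> are only reservoirs of symbols; the language consists of the symbols
  in the two sets, so it may have no function symbols or no relation symbols.
\<close>

record ('f, 'r) lang =
  funs :: "'f set"
  far :: "'f \<Rightarrow> nat"
  rels :: "'r set"
  rar :: "'r \<Rightarrow> nat"

text \<open>
  Free variables are named by elements of \<open>'v\<close>, bound variables are de Bruijn indices. Hence
  \<open>map_fm\<close>, which renames the free variables, is capture-free substitution of variables
  (not necessarily distinct ones) for variables.
\<close>

datatype (dead 'f, vars_tm: 'v) tm =
  Free 'v | Bound nat | App 'f "('f, 'v) tm list"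

datatype (dead 'f, dead 'r, vars_fm: 'v) fm =
  Equ "('f, 'v) tm" "('f, 'v) tm"
| Rel 'r "('f, 'v) tm list"
| Neg "('f, 'r, 'v) fm"
| And "('f, 'r, 'v) fm" "('f, 'r, 'v) fm"
| All "('f, 'r, 'v) fm"

primrec wf_tm :: "('f, 'r) lang \<Rightarrow> nat \<Rightarrow> ('f, 'v) tm \<Rightarrow> bool" where
  "wf_tm L n (Free v) \<longleftrightarrow> True"
| "wf_tm L n (Bound i) \<longleftrightarrow> i < n"
| "wf_tm L n (App f ts) \<longleftrightarrow> f \<in> funs L \<and> length ts = far L f \<and> list_all (wf_tm L n) ts"

primrec wf_fm :: "('f, 'r) lang \<Rightarrow> nat \<Rightarrow> ('f, 'r, 'v) fm \<Rightarrow> bool" where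
  "wf_fm L n (Equ s t) \<longleftrightarrow> wf_tm L n s \<and> wf_tm L n t"
| "wf_fm L n (Rel r ts) \<longleftrightarrow> r \<in> rels L \<and> length ts = rar L r \<and> (\<forall>t\<in>set ts. wf_tm L n t)"
| "wf_fm L n (Neg \<phi>) \<longleftrightarrow> wf_fm L n \<phi>"
| "wf_fm L n (And \<phi> \<psi>) \<longleftrightarrow> wf_fm L n \<phi> \<and> wf_fm L n \<psi>"
| "wf_fm L n (All \<phi>) \<longleftrightarrow> wf_fm L (Suc n) \<phi>"

record ('m, 'f, 'r) fo_structure =
  univ :: "'m set"
  fint :: "'f \<Rightarrow> 'm list \<Rightarrow> 'm"
  rint :: "'r \<Rightarrow> 'm list \<Rightarrow> bool"

definition is_structure :: "('f, 'r) lang \<Rightarrow> ('m, 'f, 'r) fo_structure \<Rightarrow> bool" where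
  "is_structure L M \<longleftrightarrow> univ M \<noteq> {} \<and>
     (\<forall>f\<in>funs L. \<forall>as. length as = far L f \<and> set as \<subseteq> univ M \<longrightarrow> fint M f as \<in> univ M)"

primrec eval_tm ::
  "('m, 'f, 'r) fo_structure \<Rightarrow> 'm list \<Rightarrow> ('v \<Rightarrow> 'm) \<Rightarrow> ('f, 'v) tm \<Rightarrow> 'm" where
  "eval_tm M bs e (Free v) = e v"
| "eval_tm M bs e (Bound i) = bs ! i"
| "eval_tm M bs e (App f ts) = fint M f (map (eval_tm M bs e) ts)"

primrec sat ::
  "('m, 'f, 'r) fo_structure \<Rightarrow> 'm list \<Rightarrow> ('v \<Rightarrow> 'm) \<Rightarrow> ('f, 'r, 'v) fm \<Rightarrow> bool" where
  "sat M bs e (Equ s t) \<longleftrightarrow> eval_tm M bs e s = eval_tm M bs e t"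
| "sat M bs e (Rel r ts) \<longleftrightarrow> rint M r (map (eval_tm M bs e) ts)"
| "sat M bs e (Neg \<phi>) \<longleftrightarrow> \<not> sat M bs e \<phi>"
| "sat M bs e (And \<phi> \<psi>) \<longleftrightarrow> sat M bs e \<phi> \<and> sat M bs e \<psi>"
| "sat M bs e (All \<phi>) \<longleftrightarrow> (\<forall>a\<in>univ M. sat M (a # bs) e \<phi>)"

definition sentences :: "('f, 'r) lang \<Rightarrow> ('f, 'r, nat) fm set" where
  "sentences L = {\<sigma>. wf_fm L 0 \<sigma> \<and> vars_fm \<sigma> = {}}"

definition is_model ::
  "('f, 'r) lang \<Rightarrow> ('f, 'r, nat) fm set \<Rightarrow> ('m, 'f, 'r) fo_structure \<Rightarrow> bool" where
  "is_model L T M \<longleftrightarrow> is_structure L M \<and> (\<forall>\<sigma>\<in>T. \<forall>e. sat M [] e \<sigma>)"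

text \<open>
  HOL cannot quantify over models with elements in arbitrary types. By the downward
  Loewenheim-Skolem theorem, consequence and satisfiability are not changed by restricting to
  models with at most as many elements as there are formulas, so it suffices to consider models
  whose elements are taken from the (infinite) type of formulas.
\<close>

definition complete_theory :: "('f, 'r) lang \<Rightarrow> ('f, 'r, nat) fm set \<Rightarrow> bool" where
  "complete_theory L T \<longleftrightarrow> T \<subseteq> sentences L \<and>
     (\<exists>M :: (('f, 'r, nat) fm, 'f, 'r) fo_structure. is_model L T M) \<and>
     (\<forall>\<sigma>\<in>sentences L.
        (\<forall>M :: (('f, 'r, nat) fm, 'f, 'r) fo_structure. is_model L T M \<longrightarrow> is_model L {\<sigma>} M) \<or>
        (\<forall>M :: (('f, 'r, nat) fm, 'f, 'r) fo_structure. is_model L T M \<longrightarrow> is_model L {Neg \<sigma>} M))"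

text \<open>
  \<open>fmla L k Y\<close> is the set of formulas $\varphi(x, y)$ with $x = (x_0, \dots, x_{k-1})$ and
  $y = (y_j)_{j \in Y}$, where \<open>Inl i\<close> stands for $x_i$ and \<open>Inr j\<close> for $y_j$. A formula in \<open>x\<close>
  with parameters in a set \<open>A\<close> of elements is a member of \<open>fmla L k A\<close>, to be evaluated at the
  assignment \<open>y = id\<close>.
\<close>

definition fmla :: "('f, 'r) lang \<Rightarrow> nat \<Rightarrow> 'y set \<Rightarrow> ('f, 'r, nat + 'y) fm set" where
  "fmla L k Y = {\<phi>. wf_fm L 0 \<phi> \<and> vars_fm \<phi> \<subseteq> Inl ` {..<k} \<union> Inr ` Y}"

definition holds ::
  "('m, 'f, 'r) fo_structure \<Rightarrow> ('f, 'r, nat + 'y) fm \<Rightarrow> 'm list \<Rightarrow> ('y \<Rightarrow> 'm) \<Rightarrow> bool" where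
  "holds M \<phi> a c \<longleftrightarrow> sat M [] (case_sum (\<lambda>i. a ! i) c) \<phi>"

definition tuples :: "('m, 'f, 'r) fo_structure \<Rightarrow> nat \<Rightarrow> 'm list set" where
  "tuples M k = {a. length a = k \<and> set a \<subseteq> univ M}"

text \<open>The set $p(M, c)$.\<close>

definition realizations ::
  "('m, 'f, 'r) fo_structure \<Rightarrow> nat \<Rightarrow> ('f, 'r, nat + 'y) fm set \<Rightarrow> ('y \<Rightarrow> 'm) \<Rightarrow> 'm list set" where
  "realizations M k p c = {a \<in> tuples M k. \<forall>\<phi>\<in>p. holds M \<phi> a c}"

definition has_IP ::
  "('m, 'f, 'r) fo_structure \<Rightarrow> nat \<Rightarrow> nat \<Rightarrow> ('f, 'r, nat + nat) fm \<Rightarrow> bool" where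
  "has_IP M k l \<phi> \<longleftrightarrow>
     (\<forall>n. \<exists>(a :: nat \<Rightarrow> 'm list) (b :: nat set \<Rightarrow> 'm list).
        (\<forall>i<n. a i \<in> tuples M k) \<and> (\<forall>s\<subseteq>{..<n}. b s \<in> tuples M l) \<and>
        (\<forall>i<n. \<forall>s\<subseteq>{..<n}. holds M \<phi> (a i) (\<lambda>j. b s ! j) \<longleftrightarrow> i \<in> s))"

text \<open>
  The models range over those with elements in \<open>'m\<close>. For a complete theory having a model in
  \<open>'m\<close> this is no restriction, since for each \<open>n\<close> the existence of the \<open>a\<^sub>i\<close> and \<open>b\<^sub>s\<close> is
  expressed by a sentence.
\<close>

definition dependent ::
  "'m itself \<Rightarrow> ('f, 'r) lang \<Rightarrow> ('f, 'r, nat) fm set \<Rightarrow> bool" where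
  "dependent _ L T \<longleftrightarrow>
     (\<nexists>(M :: ('m, 'f, 'r) fo_structure) k l \<phi>.
        is_model L T M \<and> \<phi> \<in> fmla L k {..<l} \<and> has_IP M k l \<phi>)"

text \<open>
  Sets of cardinality less than \<open>\<mu>\<close> are called small. In \<open>saturated\<close> the first conjunct makes an
  infinite structure have cardinality exactly \<open>\<mu>\<close> (the second one yields the other inequality),
  as saturation means; finite structures, which occur if \<open>T\<close> has finite models, are saturated too.
\<close>

definition saturated ::
  "('f, 'r) lang \<Rightarrow> 'k rel \<Rightarrow> ('m, 'f, 'r) fo_structure \<Rightarrow> bool" where
  "saturated L \<mu> M \<longleftrightarrow> |univ M| \<le>o \<mu> \<and>
     (\<forall>n A q. A \<subseteq> univ M \<and> |A| <o \<mu> \<and> q \<subseteq> fmla L n A \<and>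
        (\<forall>q0. finite q0 \<and> q0 \<subseteq> q \<longrightarrow> realizations M n q0 id \<noteq> {}) \<longrightarrow>
        realizations M n q id \<noteq> {})"

definition elementary_embedding ::
  "('f, 'r) lang \<Rightarrow> ('m \<Rightarrow> 'm) \<Rightarrow> ('m, 'f, 'r) fo_structure \<Rightarrow> ('m, 'f, 'r) fo_structure \<Rightarrow> bool" where
  "elementary_embedding L h N M \<longleftrightarrow> h ` univ N \<subseteq> univ M \<and>
     (\<forall>(\<phi> :: ('f, 'r, nat) fm) e. wf_fm L 0 \<phi> \<and> range e \<subseteq> univ N \<longrightarrow>
        (sat N [] e \<phi> \<longleftrightarrow> sat M [] (h \<circ> e) \<phi>))"

text \<open>
  In the last conjunct it is enough to consider models with elements in \<open>'m\<close>: all small models of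
  \<open>T\<close> have isomorphic copies there.
\<close>

definition monster_model ::
  "('f, 'r) lang \<Rightarrow> ('f, 'r, nat) fm set \<Rightarrow> 'k rel \<Rightarrow> ('m, 'f, 'r) fo_structure \<Rightarrow> bool" where
  "monster_model L T \<mu> C \<longleftrightarrow> Card_order \<mu> \<and> |{\<phi> :: ('f, 'r, nat) fm. wf_fm L 0 \<phi>}| <o \<mu> \<and>
     is_model L T C \<and> saturated L \<mu> C \<and>
     (\<forall>N :: ('m, 'f, 'r) fo_structure. is_model L T N \<and> |univ N| <o \<mu> \<longrightarrow>
        (\<exists>h. elementary_embedding L h N C))"

definition type_definable_group ::
  "('f, 'r) lang \<Rightarrow> 'k rel \<Rightarrow> ('m, 'f, 'r) fo_structure \<Rightarrow> nat \<Rightarrow> 'm list monoid \<Rightarrow> bool" where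
  "type_definable_group L \<mu> C k G \<longleftrightarrow> group G \<and>
     (\<exists>A \<Sigma> \<nu>. A \<subseteq> univ C \<and> |A| <o \<mu> \<and> \<Sigma> \<subseteq> fmla L k A \<and> \<nu> \<in> fmla L (3 * k) A \<and>
        carrier G = realizations C k \<Sigma> id \<and>
        (\<forall>a\<in>carrier G. \<forall>b\<in>carrier G. \<forall>c\<in>carrier G.
           holds C \<nu> (a @ b @ c) id \<longleftrightarrow> a \<otimes>\<^bsub>G\<^esub> b = c))"

definition uniformly_type_definable_subgroups ::
  "('m, 'f, 'r) fo_structure \<Rightarrow> nat \<Rightarrow> 'm list monoid \<Rightarrow> 'y set \<Rightarrow> ('f, 'r, nat + 'y) fm set \<Rightarrow>
     'm list set set \<Rightarrow> bool" where
  "uniformly_type_definable_subgroups C k G Y p \<FF> \<longleftrightarrow>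
     (\<forall>F\<in>\<FF>. subgroup F G \<and> (\<exists>c. c ` Y \<subseteq> univ C \<and> F = realizations C k p c))"

text \<open>
  $|p|$, the number of formulas $\varphi(x, z_0, \dots, z_{n-1})$ such that
  $\varphi(x, y_0, \dots, y_{n-1}) \in p$ for some tuple from $y$ (repetitions allowed). As usual the
  free variables of $\varphi(x, z_0, \dots, z_{n-1})$ are among those displayed, so
  $\varphi(x, z_0)$ and $\varphi(x, z_1)$ are both counted and an infinite \<open>p\<close> has infinite size, even
  if its members are instances of one formula. For a finite \<open>p\<close> every \<open>z\<^sub>i\<close> is required to occur,
  so that its size is finite.
\<close>

definition type_size ::
  "('f, 'r) lang \<Rightarrow> nat \<Rightarrow> 'y set \<Rightarrow> ('f, 'r, nat + 'y) fm set \<Rightarrow> ('f, 'r, nat + nat) fm rel" where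
  "type_size L k Y p =
     |{\<phi>. \<exists>n ys. \<phi> \<in> fmla L k {..<n} \<and> ys ` {..<n} \<subseteq> Y \<and> map_fm (map_sum id ys) \<phi> \<in> p \<and>
          (finite p \<longrightarrow> Inr ` {..<n} \<subseteq> vars_fm \<phi>)}|"

definition regular_cardinal :: "'k rel \<Rightarrow> bool" where
  "regular_cardinal \<kappa> \<longleftrightarrow> Cinfinite \<kappa> \<and> regularCard \<kappa>"

definition card_Inter :: "'k rel \<Rightarrow> 'a monoid \<Rightarrow> 'a set set \<Rightarrow> 'a set" where
  "card_Inter \<kappa> G \<FF> = {g \<in> carrier G. |{F \<in> \<FF>. g \<notin> F}| <o \<kappa>}"

end

theory Submission
  imports Defs "HOL-Algebra.Free_Abelian_Groups"
begin

text \<open>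
  Assume that no small \<open>\<GG>'\<close> works. Whenever fewer than \<open>\<kappa>\<close> pairs $(g, F)$ have been chosen with $g$
  in the \<open>\<kappa>\<close>-intersection, the members of \<open>\<GG>\<close> omitting one of the chosen $g$ form, by regularity,
  a small family \<open>\<GG>'\<close>; as it fails, some $g$ in the \<open>\<kappa>\<close>-intersection lies in all of \<open>\<GG>'\<close> but not in
  some \<open>F \<in> \<GG>\<close>. Not being in \<open>\<GG>'\<close>, this $F$ contains the $g$ chosen before. So $(g, F)$ extends the
  choice, and in the end there are at least
  \<open>\<kappa>\<close> pairs $(g_i, F_i)$ such that $g_i \in F_j$ iff $i \neq j$
  (\<open>large_separated_set\<close>, where Zorn's lemma replaces the recursion).

  For a finite set $s$ of indices the product $h_s$ of the $g_i$ with $i \in s$ lies in $F_j$ if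
  $j \notin s$, while $g_j = a h_s b$ with $a, b \in F_j$ if $j \in s$ (\<open>separating_product\<close>). The
  type $p(x, c_j)$ of $F_j$ thus tells by $h_s$ whether $j \in s$. To have this done by one formula,
  pick $\varphi \in p$ with $\neg\varphi(g_j, c_j)$. Since $F_j$ is closed under multiplication,
  $p(x, c_j)$, $p(y, c_j)$ and $p(z, c_j)$ imply $\varphi(xyz, c_j)$, and by saturation a finite part
  $p_j$ of $p$ suffices for $y$ (\<open>subgroup_type_two_sided\<close>). So $p_j(h_s, c_j)$ fails for $j \in s$:
  otherwise $\varphi(a h_s b, c_j)$ would hold.

  The finite set $p_j$ consists of instances of formulas $\varphi(x, z_0, \dots, z_{n-1})$, and there
  are fewer than \<open>\<kappa>\<close> finite sets of these that occur (\<open>common_schemes\<close>). By regularity the same set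
  occurs for infinitely many $j$, and the negation of its conjunction, with the variables $x$ and
  $z$ exchanged, has the independence property (\<open>has_IP_of_omitted_subsets\<close>).
\<close>

section \<open>Renaming variables and conjunctions\<close>

lemma eval_tm_map: "eval_tm M bs e (map_tm f t) = eval_tm M bs (e \<circ> f) t"
  by (induction t) (auto cong: map_cong simp: comp_def)

lemma sat_map: "sat M bs e (map_fm f \<phi>) \<longleftrightarrow> sat M bs (e \<circ> f) \<phi>"
  by (induction \<phi> arbitrary: bs) (simp_all add: eval_tm_map comp_def)

lemma eval_tm_cong: "(\<And>v. v \<in> vars_tm t \<Longrightarrow> e v = e' v) \<Longrightarrow> eval_tm M bs e t = eval_tm M bs e' t"
proof (induction t)
  case (App f ts)
  have "map (eval_tm M bs e) ts = map (eval_tm M bs e') ts"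
    using App by (intro map_cong) auto
  then show ?case by (simp del: map_eq_conv)
qed auto

lemma sat_cong: "(\<And>v. v \<in> vars_fm \<phi> \<Longrightarrow> e v = e' v) \<Longrightarrow> sat M bs e \<phi> \<longleftrightarrow> sat M bs e' \<phi>"
proof (induction \<phi> arbitrary: bs)
  case (Equ s t)
  then show ?case by (auto cong: eval_tm_cong)
next
  case (Rel r ts)
  have "map (eval_tm M bs e) ts = map (eval_tm M bs e') ts"
    using Rel by (intro map_cong eval_tm_cong) auto
  then show ?case by (simp del: map_eq_conv)
next
  case (Neg \<phi>)
  have "sat M bs e \<phi> \<longleftrightarrow> sat M bs e' \<phi>" using Neg.prems by (intro Neg.IH) auto
  then show ?case by simp
next
  case (And \<phi> \<psi>)
  have "sat M bs e \<phi> \<longleftrightarrow> sat M bs e' \<phi>" "sat M bs e \<psi> \<longleftrightarrow> sat M bs e' \<psi>"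
    using And.prems by (intro And.IH; auto)+
  then show ?case by simp
next
  case (All \<phi>)
  have "sat M (a # bs) e \<phi> \<longleftrightarrow> sat M (a # bs) e' \<phi>" for a
    using All.prems by (intro All.IH) auto
  then show ?case by simp
qed

lemma wf_tm_map [simp]: "wf_tm L n (map_tm f t) \<longleftrightarrow> wf_tm L n t"
  by (induction t) (auto simp: list_all_iff)

lemma wf_fm_map [simp]: "wf_fm L n (map_fm f \<phi>) \<longleftrightarrow> wf_fm L n \<phi>"
  by (induction \<phi> arbitrary: n) auto

lemma finite_vars_tm: "finite (vars_tm t)"
  by (induction t) auto

lemma finite_vars_fm: "finite (vars_fm \<phi>)"
  by (induction \<phi>) (auto simp: finite_vars_tm)

lemma holds_map:
  "holds M (map_fm (map_sum f h) \<phi>) a d \<longleftrightarrow> sat M [] (case_sum (\<lambda>i. a ! f i) (d \<circ> h)) \<phi>"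
  unfolding holds_def sat_map
  by (intro sat_cong) (auto split: sum.split simp: map_sum_def)

lemma holds_instance:
  "holds M (map_fm (map_sum id h) \<phi>) a d \<longleftrightarrow> holds M \<phi> a (d \<circ> h)"
  unfolding holds_map by (simp add: holds_def)

lemma holds_cong:
  assumes "\<phi> \<in> fmla L k Z" "\<And>i. i < k \<Longrightarrow> a ! i = a' ! i" "\<And>z. z \<in> Z \<Longrightarrow> d z = d' z"
  shows "holds M \<phi> a d \<longleftrightarrow> holds M \<phi> a' d'"
  using assms unfolding holds_def fmla_def by (intro sat_cong) auto

lemma holds_Neg [simp]: "holds M (Neg \<phi>) a d \<longleftrightarrow> \<not> holds M \<phi> a d"
  by (simp add: holds_def)

lemma Neg_in_fmla [simp]: "Neg \<phi> \<in> fmla L k Z \<longleftrightarrow> \<phi> \<in> fmla L k Z"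
  by (simp add: fmla_def)

lemma fmla_Int: "\<phi> \<in> fmla L k Z \<Longrightarrow> \<phi> \<in> fmla L k W \<Longrightarrow> \<phi> \<in> fmla L k (Z \<inter> W)"
  unfolding fmla_def by blast

lemma conjunction_in_fmla:
  assumes "finite \<Phi>" "\<Phi> \<subseteq> fmla L k Z"
  shows "\<exists>\<chi> \<in> fmla L k Z. \<forall>(M :: ('m, 'f, 'r) fo_structure) a d.
           holds M \<chi> a d \<longleftrightarrow> (\<forall>\<phi>\<in>\<Phi>. holds M \<phi> a d)"
  using assms
proof (induction \<Phi> rule: finite_induct)
  case empty
  have "All (Equ (Bound 0) (Bound 0)) \<in> fmla L k Z" by (simp add: fmla_def)
  then show ?case by (intro bexI) (auto simp: holds_def)
next
  case (insert \<phi> \<Phi>)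
  then obtain \<chi> where \<chi>: "\<chi> \<in> fmla L k Z"
    "\<forall>(M :: ('m, 'f, 'r) fo_structure) a d. holds M \<chi> a d \<longleftrightarrow> (\<forall>\<phi>\<in>\<Phi>. holds M \<phi> a d)"
    by auto
  have "And \<phi> \<chi> \<in> fmla L k Z" using \<chi>(1) insert.prems by (auto simp: fmla_def)
  then show ?case using \<chi>(2) by (intro bexI) (auto simp: holds_def)
qed

lemma map_in_fmla:
  assumes \<phi>: "\<phi> \<in> fmla L k Z" and f: "\<And>i. i < k \<Longrightarrow> f i < n" and h: "\<And>z. z \<in> Z \<Longrightarrow> h z \<in> W"
  shows "map_fm (map_sum f h) \<phi> \<in> fmla L n W"
proof -
  have "map_sum f h v \<in> Inl ` {..<n} \<union> Inr ` W" if "v \<in> vars_fm \<phi>" for v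
  proof -
    have "v \<in> Inl ` {..<k} \<union> Inr ` Z" using that \<phi> unfolding fmla_def by blast
    then show ?thesis using f h by auto
  qed
  then have "vars_fm (map_fm (map_sum f h) \<phi>) \<subseteq> Inl ` {..<n} \<union> Inr ` W"
    unfolding fm.set_map by (rule image_subsetI)
  then show ?thesis using \<phi> by (simp add: fmla_def)
qed

text \<open>
  A formula in a $k$-tuple becomes one about the block of length $k$ starting at position \<open>off\<close> of a
  longer tuple; types in several tuples are thereby written as types in a single one. The function
  \<open>h\<close> acts on the variables \<open>y\<close>, and serves to replace them by elements of the structure.
\<close>

definition shift :: "nat \<Rightarrow> ('y \<Rightarrow> 'z) \<Rightarrow> ('f, 'r, nat + 'y) fm \<Rightarrow> ('f, 'r, nat + 'z) fm" where
  "shift off h = map_fm (map_sum ((+) off) h)"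

lemma shift_in_fmla:
  assumes "\<phi> \<in> fmla L k Z" "off + k \<le> n" "h ` Z \<subseteq> W"
  shows "shift off h \<phi> \<in> fmla L n W"
  unfolding shift_def using assms(1) by (rule map_in_fmla) (use assms(2,3) in auto)

lemma holds_shift:
  assumes "\<phi> \<in> fmla L k Z" "length xs = off" "length a = k"
  shows "holds M (shift off h \<phi>) (xs @ a @ ys) d \<longleftrightarrow> holds M \<phi> a (d \<circ> h)"
  unfolding shift_def holds_map unfolding holds_def
  using assms by (intro sat_cong) (auto simp: fmla_def nth_append)

section \<open>Formulas and their instances in a partial type\<close>

text \<open>
  All formulas of the finite set are given names for their variables \<open>y\<close> by one common numbering,
  so that they can later be merged into a single formula.
\<close>

lemma finite_scheme:
  assumes "finite p0" "p0 \<subseteq> fmla L k Y"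
  obtains n :: nat and ys \<Phi> where "finite \<Phi>" "\<Phi> \<subseteq> fmla L k {..<n}" "ys ` {..<n} \<subseteq> Y"
    "map_fm (map_sum id ys) ` \<Phi> = p0"
proof -
  define V where "V = {y. \<exists>\<psi>\<in>p0. Inr y \<in> vars_fm \<psi>}"
  have "V \<subseteq> projr ` (\<Union>\<psi>\<in>p0. vars_fm \<psi>)" by (force simp: V_def image_iff)
  moreover have "finite (\<Union>\<psi>\<in>p0. vars_fm \<psi>)" using assms(1) by (simp add: finite_vars_fm)
  ultimately have "finite V" by (meson finite_imageI finite_subset)
  then obtain n and e :: "'c \<Rightarrow> nat" where e: "e ` V = {..<n}" "inj_on e V"
    using finite_imp_inj_to_nat_seg[of V] by (auto simp: lessThan_def)
  define ys where "ys = inv_into V e"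
  have V: "V \<subseteq> Y" using assms(2) by (fastforce simp: V_def fmla_def)
  have restore: "map_fm (map_sum id ys) (map_fm (map_sum id e) \<psi>) = \<psi>" if "\<psi> \<in> p0" for \<psi>
  proof -
    have "map_fm (map_sum id ys \<circ> map_sum id e) \<psi> = map_fm id \<psi>"
    proof (rule fm.map_cong0)
      fix v assume v: "v \<in> vars_fm \<psi>"
      show "(map_sum id ys \<circ> map_sum id e) v = id v"
      proof (cases v)
        case (Inr y)
        then have "y \<in> V" using v that by (auto simp: V_def)
        then show ?thesis using e(2) Inr by (simp add: ys_def)
      qed simp
    qed
    then show ?thesis by (simp add: fm.map_comp fm.map_id)
  qed
  have "map_fm (map_sum id e) ` p0 \<subseteq> fmla L k {..<n}"
  proof (rule image_subsetI)
    fix \<psi> assume \<psi>: "\<psi> \<in> p0"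
    then have "\<psi> \<in> fmla L k V" using assms(2) unfolding fmla_def V_def by blast
    then show "map_fm (map_sum id e) \<psi> \<in> fmla L k {..<n}"
      by (rule map_in_fmla) (use e(1) in auto)
  qed
  moreover have "ys ` {..<n} \<subseteq> Y" using V e(1) unfolding ys_def
    by (metis image_subset_iff inv_into_into subsetD)
  moreover have "map_fm (map_sum id ys) ` map_fm (map_sum id e) ` p0 = p0"
    using restore by (force simp: image_image)
  ultimately show thesis using assms(1) by (intro that[of "map_fm (map_sum id e) ` p0" n ys]) auto
qed

text \<open>
  The set counted by \<open>type_size\<close>, without the restriction that finite \<open>p\<close> are subject to there.
\<close>

definition schemes ::
  "('f, 'r) lang \<Rightarrow> nat \<Rightarrow> 'y set \<Rightarrow> ('f, 'r, nat + 'y) fm set \<Rightarrow> ('f, 'r, nat + nat) fm set" where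
  "schemes L k Y p =
     {\<phi>. \<exists>n ys. \<phi> \<in> fmla L k {..<n} \<and> ys ` {..<n} \<subseteq> Y \<and> map_fm (map_sum id ys) \<phi> \<in> p}"

lemma schemesI:
  "\<phi> \<in> fmla L k {..<n} \<Longrightarrow> ys ` {..<n} \<subseteq> Y \<Longrightarrow> map_fm (map_sum id ys) \<phi> \<in> p \<Longrightarrow> \<phi> \<in> schemes L k Y p"
  unfolding schemes_def mem_Collect_eq by (intro exI conjI)

text \<open>
  If some member of \<open>p\<close> contains a variable \<open>y\<close>, already the renamings of this one formula by
  $z_i \mapsto z_{i + m}$ are infinitely many. Otherwise no member changes when it is turned into a
  scheme, so that there are at least as many schemes as members.
\<close>

lemma infinite_schemes:
  assumes "infinite p" "p \<subseteq> fmla L k Y"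
  shows "infinite (schemes L k Y p)"
proof (cases "\<exists>\<psi>\<in>p. \<exists>y. Inr y \<in> vars_fm \<psi>")
  case True
  then obtain \<psi> y where \<psi>: "\<psi> \<in> p" "Inr y \<in> vars_fm \<psi>" by auto
  have "{\<psi>} \<subseteq> fmla L k Y" using \<psi>(1) assms(2) by blast
  from finite_scheme[OF finite.insertI[OF finite.emptyI] this]
  obtain n :: nat and ys \<Phi> where "finite \<Phi>" and \<Phi>: "\<Phi> \<subseteq> fmla L k {..<n}"
    and ys: "ys ` {..<n} \<subseteq> Y" and inst: "map_fm (map_sum id ys) ` \<Phi> = {\<psi>}" .
  from inst have "\<psi> \<in> map_fm (map_sum id ys) ` \<Phi>" by simp
  then obtain \<phi> where \<phi>: "\<phi> \<in> fmla L k {..<n}" "map_fm (map_sum id ys) \<phi> = \<psi>"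
    using \<Phi> by (elim imageE) auto
  obtain i where i: "Inr i \<in> vars_fm \<phi>"
  proof -
    have "Inr y \<in> map_sum id ys ` vars_fm \<phi>" using \<psi>(2) \<phi>(2) fm.set_map by metis
    then obtain v where v: "v \<in> vars_fm \<phi>" "Inr y = map_sum id ys v" by auto
    show ?thesis
    proof (cases v)
      case (Inr i)
      then show ?thesis using that v(1) by blast
    qed (use v(2) in simp)
  qed
  have "i < n" using i \<phi>(1) by (auto simp: fmla_def)
  define \<phi>' where "\<phi>' m = map_fm (map_sum id (\<lambda>i. i + m)) \<phi>" for m :: nat
  have "\<phi>' m \<in> schemes L k Y p" for m
  proof -
    have "\<phi>' m \<in> fmla L k {..<n + m}"
      unfolding \<phi>'_def using \<phi>(1) by (rule map_in_fmla) auto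
    moreover have "(\<lambda>i. ys (i - m)) ` {..<n + m} \<subseteq> Y"
      using ys \<open>i < n\<close> by (auto simp: image_subset_iff)
    moreover have "map_sum id (\<lambda>i. ys (i - m)) \<circ> map_sum id (\<lambda>i. i + m) =
        (map_sum id ys :: nat + nat \<Rightarrow> nat + 'c)"
      by (rule ext) (simp add: map_sum_def split: sum.split)
    then have "map_fm (map_sum id (\<lambda>i. ys (i - m))) (\<phi>' m) = \<psi>"
      using \<phi>(2) by (simp add: \<phi>'_def fm.map_comp)
    then have "map_fm (map_sum id (\<lambda>i. ys (i - m))) (\<phi>' m) \<in> p" using \<psi>(1) by metis
    ultimately show ?thesis by (intro schemesI)
  qed
  moreover have "i + m \<in> projr ` vars_fm (\<phi>' m)" for m
  proof (rule image_eqI)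
    have "map_sum id (\<lambda>i. i + m) (Inr i) \<in> vars_fm (\<phi>' m)"
      unfolding \<phi>'_def fm.set_map using i by (rule imageI)
    then show "Inr (i + m) \<in> vars_fm (\<phi>' m)" by simp
  qed simp
  ultimately have "range (\<lambda>m. i + m) \<subseteq> (\<Union>\<phi>\<in>schemes L k Y p. projr ` vars_fm \<phi>)"
    by blast
  moreover have "infinite (range (\<lambda>m. i + m))"
    by (rule range_inj_infinite) (simp add: inj_def)
  ultimately have "infinite (\<Union>\<phi>\<in>schemes L k Y p. projr ` vars_fm \<phi>)"
    by (rule infinite_super)
  then show ?thesis by (meson finite_UN_I finite_imageI finite_vars_fm)
next
  case False
  define r :: "('a, 'b, nat + 'c) fm \<Rightarrow> ('a, 'b, nat + nat) fm" where "r = map_fm (map_sum id (\<lambda>_. 0))"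
  define s :: "('a, 'b, nat + nat) fm \<Rightarrow> ('a, 'b, nat + 'c) fm" where "s = map_fm (map_sum id (\<lambda>_. undefined))"
  have sr: "s (r \<psi>) = \<psi>" if "\<psi> \<in> p" for \<psi>
  proof -
    have "map_fm (map_sum id (\<lambda>_. undefined) \<circ> map_sum id (\<lambda>_. 0 :: nat)) \<psi> = map_fm id \<psi>"
    proof (rule fm.map_cong0)
      fix v assume v: "v \<in> vars_fm \<psi>"
      show "(map_sum id (\<lambda>_. undefined) \<circ> map_sum id (\<lambda>_. 0 :: nat)) v = id v"
        by (cases v) (use v False that in auto)
    qed
    then show ?thesis by (simp add: r_def s_def fm.map_comp fm.map_id)
  qed
  have "r ` p \<subseteq> schemes L k Y p"
  proof (rule image_subsetI)
    fix \<psi> assume \<psi>: "\<psi> \<in> p"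
    have "vars_fm \<psi> \<subseteq> Inl ` {..<k}" using False \<psi> assms(2) unfolding fmla_def by blast
    then have "r \<psi> \<in> fmla L k {..<0}" using \<psi> assms(2)
      by (auto simp: fmla_def r_def fm.set_map)
    then show "r \<psi> \<in> schemes L k Y p"
      by (rule schemesI[where ys = "\<lambda>_. undefined"]) (use sr[OF \<psi>] \<psi> in \<open>simp_all add: s_def\<close>)
  qed
  moreover have "inj_on r p" by (metis sr inj_onI)
  ultimately show ?thesis using assms(1) finite_imageD finite_subset by metis
qed

lemma Fpow_ordLess:
  assumes "infinite A" "|A| <o r"
  shows "|Fpow A| <o r"
  using eqpoll_Fpow[OF assms(1)] assms(2) eqpoll_iff_card_of_ordIso ordIso_ordLess_trans by blast

lemma finite_ordLess_regular: "finite A \<Longrightarrow> regular_cardinal \<kappa> \<Longrightarrow> |A| <o \<kappa>"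
  using Cfinite_ordLess_Cinfinite[of "|A|" \<kappa>]
  by (simp add: regular_cardinal_def cfinite_def Field_card_of)

text \<open>
  This is the counting step: finitely many formulas are attached to every index, and fewer than
  \<open>\<kappa>\<close> sets of schemes account for all of them. If \<open>p\<close> is infinite, so is its set of
  schemes, which therefore has no more finite subsets than elements. If \<open>p\<close> is finite, \<open>\<kappa>\<close> may be
  countable and the finite subsets cannot be counted in that way; then one set of schemes for all
  of \<open>p\<close> serves every index. This is why the instances at \<open>i\<close> are only required to lie between
  \<open>q i\<close> and \<open>p\<close>.
\<close>

lemma common_schemes:
  fixes \<kappa> :: "'k rel" and q :: "'i \<Rightarrow> ('f, 'r, nat + 'y) fm set"
  assumes "regular_cardinal \<kappa>" "type_size L k Y p <o \<kappa>" "p \<subseteq> fmla L k Y"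
    and q_all: "\<forall>i\<in>I. finite (q i) \<and> q i \<subseteq> p"
  shows "\<exists>\<Phi> (n :: 'i \<Rightarrow> nat) ys. |\<Phi> ` I| <o \<kappa> \<and> (\<forall>i\<in>I. finite (\<Phi> i) \<and> \<Phi> i \<subseteq> fmla L k {..<n i} \<and>
           ys i ` {..<n i} \<subseteq> Y \<and> q i \<subseteq> map_fm (map_sum id (ys i)) ` \<Phi> i \<and>
           map_fm (map_sum id (ys i)) ` \<Phi> i \<subseteq> p)"
proof (cases "finite p")
  case True
  note q = bspec[OF q_all]
  obtain n :: nat and ys \<Phi> where *: "finite \<Phi>" "\<Phi> \<subseteq> fmla L k {..<n}" "ys ` {..<n} \<subseteq> Y"
      "map_fm (map_sum id ys) ` \<Phi> = p"
    using finite_scheme[OF True assms(3)] .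
  have "finite ((\<lambda>_. \<Phi>) ` I)" by (rule finite_subset[of _ "{\<Phi>}"]) auto
  then have "|(\<lambda>_. \<Phi>) ` I| <o \<kappa>" using assms(1) by (intro finite_ordLess_regular)
  then show ?thesis using * q
    by (intro exI[of _ "\<lambda>_. \<Phi>"] exI[of _ "\<lambda>_. n"] exI[of _ "\<lambda>_. ys"]) auto
next
  case False
  note q = bspec[OF q_all]
  have "\<exists>\<Phi> (n :: nat) ys. finite \<Phi> \<and> \<Phi> \<subseteq> fmla L k {..<n} \<and> ys ` {..<n} \<subseteq> Y \<and>
      map_fm (map_sum id ys) ` \<Phi> = q i" if "i \<in> I" for i
  proof -
    have "finite (q i)" "q i \<subseteq> fmla L k Y" using q[OF that] assms(3) by auto
    from finite_scheme[OF this] show ?thesis by metis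
  qed
  then have "\<forall>i\<in>I. \<exists>\<Phi> (n :: nat) ys. finite \<Phi> \<and> \<Phi> \<subseteq> fmla L k {..<n} \<and> ys ` {..<n} \<subseteq> Y \<and>
      map_fm (map_sum id ys) ` \<Phi> = q i" by blast
  then obtain \<Phi> and n :: "'i \<Rightarrow> nat" and ys where all: "\<forall>i\<in>I. finite (\<Phi> i) \<and> \<Phi> i \<subseteq> fmla L k {..<n i} \<and>
      ys i ` {..<n i} \<subseteq> Y \<and> map_fm (map_sum id (ys i)) ` \<Phi> i = q i"
    unfolding bchoice_iff by (elim exE) (rule that)
  note * = bspec[OF all]
  have "\<Phi> ` I \<subseteq> Fpow (schemes L k Y p)"
  proof (rule image_subsetI)
    fix i assume i: "i \<in> I"
    have "\<Phi> i \<subseteq> schemes L k Y p"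
    proof
      fix \<phi> assume "\<phi> \<in> \<Phi> i"
      then show "\<phi> \<in> schemes L k Y p"
        using *[OF i] q[OF i] by (intro schemesI[where n = "n i" and ys = "ys i"]) auto
    qed
    then show "\<Phi> i \<in> Fpow (schemes L k Y p)" using *[OF i] by (simp add: Fpow_def)
  qed
  moreover have "|schemes L k Y p| <o \<kappa>"
    using assms(2) False by (simp add: type_size_def schemes_def)
  then have "|Fpow (schemes L k Y p)| <o \<kappa>"
    using infinite_schemes[OF False assms(3)] by (intro Fpow_ordLess)
  ultimately have "|\<Phi> ` I| <o \<kappa>" by (rule ordLeq_ordLess_trans[OF card_of_mono1])
  then show ?thesis using * q
    by (intro exI[of _ \<Phi>] exI[of _ n] exI[of _ ys] conjI ballI) simp_all
qed

lemma infinite_fibre: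
  assumes "regular_cardinal \<kappa>" "|f ` I| <o \<kappa>" "\<not> |I| <o \<kappa>"
  shows "\<exists>x. infinite {i \<in> I. f i = x}"
proof (rule ccontr)
  assume "\<nexists>x. infinite {i \<in> I. f i = x}"
  then have "|{i \<in> I. f i = x}| <o \<kappa>" for x using assms(1) by (intro finite_ordLess_regular) auto
  then have "|\<Union>x\<in>f ` I. {i \<in> I. f i = x}| <o \<kappa>"
    using assms(1,2)
    by (intro card_of_UNION_ordLess_infinite_Field_regularCard) (auto simp: regular_cardinal_def)
  moreover have "(\<Union>x\<in>f ` I. {i \<in> I. f i = x}) = I" by auto
  ultimately show False using assms(3) by metis
qed

section \<open>Separated elements and subgroups\<close>

text \<open>
  A maximal separated set of pairs $(g, F)$ with $g$ in the \<open>\<kappa>\<close>-intersection cannot have fewer than \<open>\<kappa>\<close>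
  elements: the members of \<open>\<GG>\<close> that omit one of its $g$ would be fewer than \<open>\<kappa>\<close>, and the failure of
  this subfamily yields a further pair. Membership of $g$ in the \<open>\<kappa>\<close>-intersection is what
  keeps this subfamily small.
\<close>

lemma large_separated_set:
  fixes G :: "'a monoid" and \<GG> :: "'a set set"
  assumes \<kappa>: "regular_cardinal \<kappa>"
    and no: "\<not> (\<exists>\<GG>'\<subseteq>\<GG>. |\<GG>'| <o \<kappa> \<and>
           carrier G \<inter> \<Inter>\<GG> = (carrier G \<inter> \<Inter>\<GG>') \<inter> card_Inter \<kappa> G \<GG>)"
  shows "\<exists>P \<subseteq> carrier G \<times> \<GG>. (\<forall>x\<in>P. \<forall>y\<in>P. fst x \<in> snd y \<longleftrightarrow> x \<noteq> y) \<and> \<not> |P| <o \<kappa>"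
proof -
  define \<A> where "\<A> = {P. (\<forall>x\<in>P. fst x \<in> card_Inter \<kappa> G \<GG> \<and> snd x \<in> \<GG>) \<and>
    (\<forall>x\<in>P. \<forall>y\<in>P. fst x \<in> snd y \<longleftrightarrow> x \<noteq> y)}"
  have "\<exists>P\<in>\<A>. \<forall>Q\<in>\<A>. P \<subseteq> Q \<longrightarrow> Q = P"
  proof (rule subset_Zorn')
    fix \<C> assume \<C>: "subset.chain \<A> \<C>"
    have "fst x \<in> snd y \<longleftrightarrow> x \<noteq> y" if "x \<in> P" "P \<in> \<C>" "y \<in> Q" "Q \<in> \<C>" for x y P Q
    proof -
      have "P \<subseteq> Q \<or> Q \<subseteq> P" using \<C> that by (meson subset_chain_def)
      then have "\<exists>R\<in>\<C>. x \<in> R \<and> y \<in> R" using that by blast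
      then show ?thesis using \<C> by (auto simp: subset_chain_def \<A>_def)
    qed
    moreover have "fst x \<in> card_Inter \<kappa> G \<GG> \<and> snd x \<in> \<GG>" if "x \<in> P" "P \<in> \<C>" for x P
      using that \<C> by (auto simp: subset_chain_def \<A>_def)
    ultimately show "\<Union>\<C> \<in> \<A>" by (simp add: \<A>_def)
  qed
  then obtain P where P: "P \<in> \<A>" and max: "\<And>Q. Q \<in> \<A> \<Longrightarrow> P \<subseteq> Q \<Longrightarrow> Q = P" by blast
  have P1: "fst x \<in> card_Inter \<kappa> G \<GG>" "snd x \<in> \<GG>" if "x \<in> P" for x
    using P that unfolding \<A>_def by auto
  have P2: "fst x \<in> snd y \<longleftrightarrow> x \<noteq> y" if "x \<in> P" "y \<in> P" for x y
    using P that unfolding \<A>_def by blast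
  have "\<not> |P| <o \<kappa>"
  proof
    assume less: "|P| <o \<kappa>"
    define \<GG>' where "\<GG>' = (\<Union>x\<in>P. {F \<in> \<GG>. fst x \<notin> F})"
    have "\<forall>x\<in>P. |{F \<in> \<GG>. fst x \<notin> F}| <o \<kappa>"
      using P1(1) by (simp add: card_Inter_def)
    then have "|\<GG>'| <o \<kappa>" unfolding \<GG>'_def using \<kappa> less
      by (intro card_of_UNION_ordLess_infinite_Field_regularCard) (auto simp: regular_cardinal_def)
    moreover have "\<GG>' \<subseteq> \<GG>" by (auto simp: \<GG>'_def)
    ultimately have "carrier G \<inter> \<Inter>\<GG> \<noteq> (carrier G \<inter> \<Inter>\<GG>') \<inter> card_Inter \<kappa> G \<GG>"
      using no by blast
    moreover have "carrier G \<inter> \<Inter>\<GG> \<subseteq> (carrier G \<inter> \<Inter>\<GG>') \<inter> card_Inter \<kappa> G \<GG>"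
    proof
      fix g assume g: "g \<in> carrier G \<inter> \<Inter>\<GG>"
      then have "{F \<in> \<GG>. g \<notin> F} = {}" by auto
      moreover have "|{} :: 'a set set| <o \<kappa>" using \<kappa> by (intro finite_ordLess_regular) auto
      ultimately have "|{F \<in> \<GG>. g \<notin> F}| <o \<kappa>" by (simp only:)
      then show "g \<in> (carrier G \<inter> \<Inter>\<GG>') \<inter> card_Inter \<kappa> G \<GG>"
        using g \<open>\<GG>' \<subseteq> \<GG>\<close> by (auto simp: card_Inter_def)
    qed
    ultimately obtain g where g: "g \<in> carrier G" "g \<in> \<Inter>\<GG>'" "g \<in> card_Inter \<kappa> G \<GG>" "g \<notin> \<Inter>\<GG>"
      by blast
    then obtain F where F: "F \<in> \<GG>" "g \<notin> F" by blast
    have in_F: "fst x \<in> F" if "x \<in> P" for x using that F g(2) by (auto simp: \<GG>'_def)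
    have in_snd: "g \<in> snd x" if "x \<in> P" for x
      using that P1(2) P2 g(2) by (auto simp: \<GG>'_def)
    have new: "(g, F) \<notin> P" using in_snd F(2) by force
    have "insert (g, F) P \<in> \<A>" unfolding \<A>_def mem_Collect_eq
    proof (intro conjI ballI)
      fix x y assume "x \<in> insert (g, F) P" "y \<in> insert (g, F) P"
      then show "fst x \<in> snd y \<longleftrightarrow> x \<noteq> y"
        using P2 in_F in_snd F(2) new by (elim insertE) auto
    qed (use P1 F(1) g(3) in auto)
    then show False using max new by blast
  qed
  moreover have "P \<subseteq> carrier G \<times> \<GG>"
    using P1 by (auto simp: card_Inter_def mem_Times_iff)
  ultimately show ?thesis using P2 by blast
qed

text \<open>
  The element \<open>h\<close> is the product of the \<open>g i\<close> with \<open>i \<in> s\<close> in some order. For \<open>j \<in> s\<close> the factors before and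
  after \<open>g j\<close> are in \<open>F j\<close>, so \<open>h\<close> and \<open>g j\<close> differ by elements of \<open>F j\<close> on both sides; as \<open>F j\<close> need
  not be normal, these cannot be moved to one side.
\<close>

lemma (in group) separating_product:
  assumes F: "\<And>i. i \<in> I \<Longrightarrow> subgroup (F i) G" and g: "\<And>i. i \<in> I \<Longrightarrow> g i \<in> carrier G"
    and sep: "\<And>i j. i \<in> I \<Longrightarrow> j \<in> I \<Longrightarrow> i \<noteq> j \<Longrightarrow> g i \<in> F j"
    and s: "finite s" "s \<subseteq> I"
  shows "\<exists>h\<in>carrier G. (\<forall>j\<in>I - s. h \<in> F j) \<and> (\<forall>j\<in>s. \<exists>a\<in>F j. \<exists>b\<in>F j. g j = a \<otimes> h \<otimes> b)"
  using s
proof (induction s rule: finite_induct)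
  case empty
  then show ?case using F by (intro bexI[of _ \<one>]) (auto intro: subgroup.one_closed)
next
  case (insert i s)
  then obtain h where h: "h \<in> carrier G" "\<And>j. j \<in> I \<Longrightarrow> j \<notin> s \<Longrightarrow> h \<in> F j"
    "\<And>j. j \<in> s \<Longrightarrow> \<exists>a\<in>F j. \<exists>b\<in>F j. g j = a \<otimes> h \<otimes> b" by auto
  have i: "i \<in> I" "g i \<in> carrier G" using insert.prems g by auto
  show ?case
  proof (rule bexI[of _ "h \<otimes> g i"], intro conjI ballI)
    fix j assume "j \<in> I - insert i s"
    then show "h \<otimes> g i \<in> F j" using F h(2) sep i by (auto intro!: subgroup.m_closed)
  next
    fix j assume j: "j \<in> insert i s"
    show "\<exists>a\<in>F j. \<exists>b\<in>F j. g j = a \<otimes> (h \<otimes> g i) \<otimes> b"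
    proof (cases "j = i")
      case True
      have "inv h \<in> F j" "\<one> \<in> F j"
        using True i F h(2) insert.hyps by (auto intro: subgroup.m_inv_closed subgroup.one_closed)
      moreover have "g j = inv h \<otimes> (h \<otimes> g i) \<otimes> \<one>"
        using True i h(1) by (simp add: inv_solve_left)
      ultimately show ?thesis by blast
    next
      case False
      then have js: "j \<in> s" "j \<in> I" using j insert.prems by auto
      then obtain a b where ab: "a \<in> F j" "b \<in> F j" "g j = a \<otimes> h \<otimes> b" using h(3) by blast
      then have c: "a \<in> carrier G" "b \<in> carrier G"
        using F[OF js(2)] subgroup.mem_carrier by metis+
      have "inv (g i) \<otimes> b \<in> F j"
        using F[OF js(2)] ab sep[OF i(1) js(2)] False
        by (auto intro: subgroup.m_closed subgroup.m_inv_closed)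
      moreover have "h \<otimes> g i \<otimes> (inv (g i) \<otimes> b) = h \<otimes> b"
        using i c h(1) by (metis inv_closed m_assoc m_closed r_inv r_one l_one)
      then have "g j = a \<otimes> (h \<otimes> g i) \<otimes> (inv (g i) \<otimes> b)"
        using ab(3) i c h(1) by (simp add: m_assoc)
      ultimately show ?thesis using ab(1) by blast
    qed
  qed (use h i in auto)
qed

section \<open>Compactness for uniformly type definable subgroups\<close>

text \<open>
  If \<open>a\<close>, \<open>g\<close> and \<open>b\<close> satisfy \<open>p\<close>, then so does \<open>a \<otimes> g \<otimes> b\<close>. Hence the partial type saying that
  all three satisfy \<open>p\<close> but the product does not satisfy \<open>\<phi>\<close> is not realized, and saturation gives a
  finite part that is not realized either; \<open>p0\<close> collects what this part says about \<open>g\<close>. The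
  two products are variables of the type, required to satisfy the type of the group, because \<open>\<nu>\<close>
  describes the multiplication only inside the group.
\<close>

lemma subgroup_type_two_sided:
  fixes G :: "'m list monoid" and C :: "('m, 'f, 'r) fo_structure"
  assumes sat: "saturated L \<mu> C" and \<mu>: "Card_order \<mu>" "infinite (Field \<mu>)"
    and G: "type_definable_group L \<mu> C k G"
    and Y: "|Y| <o \<mu>" and p: "p \<subseteq> fmla L k Y" and c: "c ` Y \<subseteq> univ C"
    and F: "subgroup F G" "F = realizations C k p c" and \<phi>: "\<phi> \<in> p"
  shows "\<exists>p0. finite p0 \<and> p0 \<subseteq> p \<and>
    (\<forall>g\<in>carrier G. (\<forall>\<psi>\<in>p0. holds C \<psi> g c) \<longrightarrow>
       (\<forall>a\<in>F. \<forall>b\<in>F. holds C \<phi> (a \<otimes>\<^bsub>G\<^esub> g \<otimes>\<^bsub>G\<^esub> b) c))"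
proof -
  interpret G: group G using G unfolding type_definable_group_def by (rule conjunct1)
  obtain A \<Sigma> \<nu> where A: "A \<subseteq> univ C" "|A| <o \<mu>" and \<Sigma>: "\<Sigma> \<subseteq> fmla L k A"
    and \<nu>: "\<nu> \<in> fmla L (3 * k) A" and car: "carrier G = realizations C k \<Sigma> id"
    and graph: "\<forall>a\<in>carrier G. \<forall>b\<in>carrier G. \<forall>c\<in>carrier G.
      holds C \<nu> (a @ b @ c) id \<longleftrightarrow> a \<otimes>\<^bsub>G\<^esub> b = c"
    using G unfolding type_definable_group_def by (elim conjE exE) (rule that)
  have mult: "holds C \<nu> (a @ b @ c) id \<longleftrightarrow> a \<otimes>\<^bsub>G\<^esub> b = c"
    if "a \<in> carrier G" "b \<in> carrier G" "c \<in> carrier G" for a b c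
    using bspec[OF bspec[OF bspec[OF graph]]] that by blast
  define B where "B = A \<union> c ` Y"
  have B: "B \<subseteq> univ C" "|B| <o \<mu>"
  proof -
    show "B \<subseteq> univ C" using A c by (auto simp: B_def)
    have "|c ` Y| <o \<mu>" using Y card_of_image ordLeq_ordLess_trans by blast
    then show "|B| <o \<mu>" unfolding B_def using \<mu> A(2) by (intro card_of_Un_ordLess_infinite_Field)
  qed
  \<comment> \<open>The variables form five blocks, for \<open>a\<close>, \<open>g\<close>, \<open>t = a \<otimes> g\<close>, \<open>b\<close> and \<open>w = t \<otimes> b\<close> in this order:
    then \<open>(a, g, t)\<close> and \<open>(t, b, w)\<close> are both contiguous, as \<open>\<nu>\<close> needs them.\<close>
  define q where "q = shift (2 * k) id ` \<Sigma> \<union> shift (4 * k) id ` \<Sigma> \<union>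
    shift 0 c ` p \<union> shift k c ` p \<union> shift (3 * k) c ` p \<union>
    {shift 0 id \<nu>, shift (2 * k) id \<nu>, Neg (shift (4 * k) c \<phi>)}"
  have q: "q \<subseteq> fmla L (5 * k) B"
  proof -
    have 1: "shift off id ` \<Sigma> \<subseteq> fmla L (5 * k) B" if "off + k \<le> 5 * k" for off
    proof (rule image_subsetI)
      fix \<sigma> assume "\<sigma> \<in> \<Sigma>"
      then have "\<sigma> \<in> fmla L k A" using \<Sigma> by blast
      then show "shift off id \<sigma> \<in> fmla L (5 * k) B"
        using that by (rule shift_in_fmla) (simp add: B_def)
    qed
    have 2: "shift off c ` p \<subseteq> fmla L (5 * k) B" if "off + k \<le> 5 * k" for off
    proof (rule image_subsetI)
      fix \<psi> assume "\<psi> \<in> p"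
      then have "\<psi> \<in> fmla L k Y" using p by blast
      then show "shift off c \<psi> \<in> fmla L (5 * k) B"
        using that by (rule shift_in_fmla) (simp add: B_def)
    qed
    have 3: "shift off id \<nu> \<in> fmla L (5 * k) B" if "off + 3 * k \<le> 5 * k" for off
      using \<nu> that by (rule shift_in_fmla) (simp add: B_def)
    show ?thesis unfolding q_def using 1[of "2 * k"] 1[of "4 * k"] 2[of 0] 2[of k] 2[of "3 * k"]
        3[of 0] 3[of "2 * k"] subsetD[OF 2[of "4 * k"] imageI[OF \<phi>]]
      by (intro Un_least insert_subsetI empty_subsetI) simp_all
  qed
  have len: "length a = k" if "a \<in> carrier G" for a
    using that by (simp add: car realizations_def tuples_def)
  have FG: "F \<subseteq> carrier G" using F(1) by (rule subgroup.subset)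
  have q_holds:
    "\<sigma> \<in> \<Sigma> \<Longrightarrow> holds C (shift (2 * k) id \<sigma>) (a @ g @ t @ b @ w) id \<longleftrightarrow> holds C \<sigma> t id"
    "\<sigma> \<in> \<Sigma> \<Longrightarrow> holds C (shift (4 * k) id \<sigma>) (a @ g @ t @ b @ w) id \<longleftrightarrow> holds C \<sigma> w id"
    "\<psi> \<in> p \<Longrightarrow> holds C (shift 0 c \<psi>) (a @ g @ t @ b @ w) id \<longleftrightarrow> holds C \<psi> a c"
    "\<psi> \<in> p \<Longrightarrow> holds C (shift k c \<psi>) (a @ g @ t @ b @ w) id \<longleftrightarrow> holds C \<psi> g c"
    "\<psi> \<in> p \<Longrightarrow> holds C (shift (3 * k) c \<psi>) (a @ g @ t @ b @ w) id \<longleftrightarrow> holds C \<psi> b c"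
    "holds C (shift 0 id \<nu>) (a @ g @ t @ b @ w) id \<longleftrightarrow> holds C \<nu> (a @ g @ t) id"
    "holds C (shift (2 * k) id \<nu>) (a @ g @ t @ b @ w) id \<longleftrightarrow> holds C \<nu> (t @ b @ w) id"
    "\<psi> \<in> p \<Longrightarrow> holds C (shift (4 * k) c \<psi>) (a @ g @ t @ b @ w) id \<longleftrightarrow> holds C \<psi> w c"
    if l: "length a = k" "length g = k" "length t = k" "length b = k" "length w = k"
    for a g t b w \<sigma> \<psi>
  proof -
    show "holds C (shift (2 * k) id \<sigma>) (a @ g @ t @ b @ w) id \<longleftrightarrow> holds C \<sigma> t id"
      "holds C (shift (4 * k) id \<sigma>) (a @ g @ t @ b @ w) id \<longleftrightarrow> holds C \<sigma> w id" if "\<sigma> \<in> \<Sigma>"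
      using that \<Sigma> l holds_shift[of \<sigma> L k A "a @ g" "2 * k" t C id "b @ w" id]
        holds_shift[of \<sigma> L k A "a @ g @ t @ b" "4 * k" w C id "[]" id] by (simp_all add: subset_iff)
    show "holds C (shift 0 c \<psi>) (a @ g @ t @ b @ w) id \<longleftrightarrow> holds C \<psi> a c"
      "holds C (shift k c \<psi>) (a @ g @ t @ b @ w) id \<longleftrightarrow> holds C \<psi> g c"
      "holds C (shift (3 * k) c \<psi>) (a @ g @ t @ b @ w) id \<longleftrightarrow> holds C \<psi> b c"
      "holds C (shift (4 * k) c \<psi>) (a @ g @ t @ b @ w) id \<longleftrightarrow> holds C \<psi> w c" if "\<psi> \<in> p"
      using that p l holds_shift[of \<psi> L k Y "[]" 0 a C c "g @ t @ b @ w" id]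
        holds_shift[of \<psi> L k Y a k g C c "t @ b @ w" id]
        holds_shift[of \<psi> L k Y "a @ g @ t" "3 * k" b C c w id]
        holds_shift[of \<psi> L k Y "a @ g @ t @ b" "4 * k" w C c "[]" id] by (simp_all add: subset_iff)
    show "holds C (shift 0 id \<nu>) (a @ g @ t @ b @ w) id \<longleftrightarrow> holds C \<nu> (a @ g @ t) id"
      "holds C (shift (2 * k) id \<nu>) (a @ g @ t @ b @ w) id \<longleftrightarrow> holds C \<nu> (t @ b @ w) id"
      using \<nu> l holds_shift[of \<nu> L "3 * k" A "[]" 0 "a @ g @ t" C id "b @ w" id]
        holds_shift[of \<nu> L "3 * k" A "a @ g" "2 * k" "t @ b @ w" C id "[]" id] by simp_all
  qed
  have "realizations C (5 * k) q id = {}"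
  proof (rule ccontr)
    assume "realizations C (5 * k) q id \<noteq> {}"
    then obtain z where z: "z \<in> tuples C (5 * k)" "\<And>\<psi>. \<psi> \<in> q \<Longrightarrow> holds C \<psi> z id"
      by (auto simp: realizations_def)
    define a g t b w where d: "a = take k z" "g = take k (drop k z)" "t = take k (drop (2 * k) z)"
      "b = take k (drop (3 * k) z)" "w = drop (4 * k) z"
    have l: "length a = k" "length g = k" "length t = k" "length b = k" "length w = k"
      using z(1) by (auto simp: d tuples_def)
    have ze: "z = a @ g @ t @ b @ w"
    proof -
      have "take k (drop m z) @ drop (m + k) z = drop m z" for m
        by (metis append_take_drop_id drop_drop add.commute)
      from this[of 0] this[of k] this[of "2 * k"] this[of "3 * k"]
      show ?thesis unfolding d by (simp add: algebra_simps numeral_eq_Suc)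
    qed
    have tup: "a \<in> tuples C k" "g \<in> tuples C k" "t \<in> tuples C k" "b \<in> tuples C k" "w \<in> tuples C k"
      using z(1) l unfolding ze tuples_def by auto
    note H = q_holds[OF l, folded ze]
    have "a \<in> F" "g \<in> F" "b \<in> F"
      using H(3-5) z(2) tup unfolding F(2) realizations_def q_def by auto
    moreover have "t \<in> carrier G" "w \<in> carrier G"
      using H(1,2) z(2) tup unfolding car realizations_def q_def by auto
    moreover have "Neg (shift (4 * k) c \<phi>) \<in> q" by (simp add: q_def)
    then have "\<not> holds C \<phi> w c" using z(2) H(8)[OF \<phi>] by fastforce
    moreover have "holds C \<nu> (a @ g @ t) id" "holds C \<nu> (t @ b @ w) id"
      using H(6,7) z(2) unfolding q_def by auto
    ultimately have "a \<otimes>\<^bsub>G\<^esub> g = t" "t \<otimes>\<^bsub>G\<^esub> b = w" using mult FG by blast+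
    then have "w \<in> F" using \<open>a \<in> F\<close> \<open>g \<in> F\<close> \<open>b \<in> F\<close> F(1) subgroup.m_closed by metis
    then show False using \<open>\<not> holds C \<phi> w c\<close> \<phi> by (auto simp: F(2) realizations_def)
  qed
  then obtain q0 where q0: "finite q0" "q0 \<subseteq> q" "realizations C (5 * k) q0 id = {}"
    using sat B q unfolding saturated_def by meson
  \<comment> \<open>The map \<open>shift k c\<close> need not be injective, as \<open>c\<close> may identify variables, so \<open>p0\<close> is chosen among
    the preimages of the finitely many formulas of \<open>q0\<close> about \<open>g\<close>.\<close>
  obtain p0 where p0: "p0 \<subseteq> p" "finite p0" "q0 \<inter> shift k c ` p = shift k c ` p0"
    using finite_subset_image[of "q0 \<inter> shift k c ` p" "shift k c" p] q0(1) by auto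
  have "holds C \<phi> (a \<otimes>\<^bsub>G\<^esub> g \<otimes>\<^bsub>G\<^esub> b) c"
    if g: "g \<in> carrier G" "\<forall>\<psi>\<in>p0. holds C \<psi> g c" and ab: "a \<in> F" "b \<in> F" for g a b
  proof (rule ccontr)
    assume neg: "\<not> holds C \<phi> (a \<otimes>\<^bsub>G\<^esub> g \<otimes>\<^bsub>G\<^esub> b) c"
    define t where "t = a \<otimes>\<^bsub>G\<^esub> g"
    define w where "w = t \<otimes>\<^bsub>G\<^esub> b"
    have inG: "a \<in> carrier G" "b \<in> carrier G" "t \<in> carrier G" "w \<in> carrier G"
      using ab FG g by (auto simp: t_def w_def)
    let ?z = "a @ g @ t @ b @ w"
    note H = q_holds[OF len len len len len, OF inG(1) g(1) inG(3,2,4)]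
    have "holds C \<theta> ?z id" if "\<theta> \<in> q0" for \<theta>
    proof -
      have \<Sigma>_tw: "holds C \<sigma> t id" "holds C \<sigma> w id" if "\<sigma> \<in> \<Sigma>" for \<sigma>
        using that inG by (auto simp: car realizations_def)
      have p_ab: "holds C \<psi> a c" "holds C \<psi> b c" if "\<psi> \<in> p" for \<psi>
        using that ab by (auto simp: F(2) realizations_def)
      have \<nu>_t: "holds C \<nu> (a @ g @ t) id" and \<nu>_w: "holds C \<nu> (t @ b @ w) id"
        using mult inG g by (auto simp: t_def w_def)
      have \<phi>_w: "\<not> holds C \<phi> w c" using neg by (simp add: w_def t_def)
      show ?thesis
      proof (cases "\<theta> \<in> shift k c ` p")
        case True
        then have "\<theta> \<in> shift k c ` p0" using that unfolding p0(3)[symmetric] by (rule IntI[rotated])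
        then obtain \<psi> where \<psi>: "\<psi> \<in> p0" "\<theta> = shift k c \<psi>" by (elim imageE)
        then show ?thesis using H(4)[of \<psi>] p0(1) g(2) by (simp add: subset_iff)
      next
        case False
        have "\<theta> \<in> q" using that q0(2) by (rule subsetD[rotated])
        then show ?thesis using False unfolding q_def
          by (elim UnE imageE insertE emptyE) (simp_all add: H \<Sigma>_tw p_ab \<nu>_t \<nu>_w \<phi>_w \<phi>)
      qed
    qed
    moreover have "?z \<in> tuples C (5 * k)"
      using inG g(1) by (auto simp: car realizations_def tuples_def)
    ultimately show False using q0(3) by (auto simp: realizations_def)
  qed
  then show ?thesis using p0(1,2) by (intro exI[of _ p0]) simp
qed

section \<open>The independence property and the theorem\<close>

text \<open>
  Here the finite sets of indices correspond to the tuples \<open>h\<close> substituted for \<open>x\<close>, whereas \<open>has_IP\<close>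
  assigns them to the second group of variables; hence the exchange of variables. The negation turns
  \<open>j \<notin> s\<close> into \<open>j \<in> s\<close>.
\<close>

lemma has_IP_of_omitted_subsets:
  fixes C :: "('m, 'f, 'r) fo_structure" and J :: "'i set"
  assumes \<chi>: "\<chi> \<in> fmla L k {..<l}" and "infinite J"
    and d: "\<And>j. j \<in> J \<Longrightarrow> d j \<in> tuples C l"
    and omit: "\<And>s. finite s \<Longrightarrow> s \<subseteq> J \<Longrightarrow>
      \<exists>h\<in>tuples C k. \<forall>j\<in>J. holds C \<chi> h (\<lambda>i. d j ! i) \<longleftrightarrow> j \<notin> s"
  shows "\<exists>\<theta>\<in>fmla L l {..<k}. has_IP C l k \<theta>"
proof -
  define \<theta> where "\<theta> = Neg (map_fm (case_sum Inr Inl) \<chi>)"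
  have "\<theta> \<in> fmla L l {..<k}" using \<chi> by (auto simp: \<theta>_def fmla_def fm.set_map)
  moreover have \<theta>: "holds C \<theta> b (\<lambda>i. h ! i) \<longleftrightarrow> \<not> holds C \<chi> h (\<lambda>i. b ! i)" for b h
    unfolding \<theta>_def holds_Neg unfolding holds_def sat_map
    by (intro arg_cong[where f = Not] sat_cong) (auto split: sum.split)
  have "has_IP C l k \<theta>" unfolding has_IP_def
  proof
    fix n
    obtain e :: "nat \<Rightarrow> 'i" where e: "inj e" "range e \<subseteq> J"
      using \<open>infinite J\<close> infinite_countable_subset by blast
    obtain H where H: "\<And>s. finite s \<Longrightarrow> s \<subseteq> J \<Longrightarrow> H s \<in> tuples C k \<and>
        (\<forall>j\<in>J. holds C \<chi> (H s) (\<lambda>i. d j ! i) \<longleftrightarrow> j \<notin> s)"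
      using omit by metis
    have eJ: "e i \<in> J" for i using e(2) by auto
    have s: "finite (e ` s)" "e ` s \<subseteq> J" if "s \<subseteq> {..<n}" for s
      using that e(2) by (auto intro: finite_subset[of s "{..<n}"])
    show "\<exists>a b. (\<forall>i<n. a i \<in> tuples C l) \<and> (\<forall>s\<subseteq>{..<n}. b s \<in> tuples C k) \<and>
      (\<forall>i<n. \<forall>s\<subseteq>{..<n}. holds C \<theta> (a i) (\<lambda>j. b s ! j) \<longleftrightarrow> i \<in> s)"
    proof (intro exI[of _ "\<lambda>i. d (e i)"] exI[of _ "\<lambda>s. H (e ` s)"] conjI allI impI)
      fix i s assume "i < n" and sn: "s \<subseteq> {..<n}"
      have "holds C \<chi> (H (e ` s)) (\<lambda>j. d (e i) ! j) \<longleftrightarrow> e i \<notin> e ` s"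
        using H[OF s[OF sn]] eJ by simp
      then show "holds C \<theta> (d (e i)) (\<lambda>j. H (e ` s) ! j) \<longleftrightarrow> i \<in> s"
        using e(1) by (simp add: \<theta> inj_image_mem_iff)
    qed (use H[OF s] d eJ in auto)
  qed
  ultimately show ?thesis by blast
qed

theorem proposition3p17:
  fixes L :: "('f, 'r) lang"
    and T :: "('f, 'r, nat) fm set"
    and \<mu> :: "'l rel"
    and C :: "('m, 'f, 'r) fo_structure"
    and k :: nat
    and G :: "'m list monoid"
    and Y :: "'y set"
    and p :: "('f, 'r, nat + 'y) fm set"
    and \<FF> \<GG> :: "'m list set set"
    and \<kappa> :: "'k rel"
  assumes "complete_theory L T"
    and "dependent TYPE('m) L T"
    and "monster_model L T \<mu> C"
    and "type_definable_group L \<mu> C k G"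
    and "|Y| <o \<mu>"
    and "p \<subseteq> fmla L k Y"
    and "uniformly_type_definable_subgroups C k G Y p \<FF>"
    and "regular_cardinal \<kappa>"
    and "type_size L k Y p <o \<kappa>"
    and "\<GG> \<subseteq> \<FF>"
  shows "\<exists>\<GG>'\<subseteq>\<GG>. |\<GG>'| <o \<kappa> \<and>
           carrier G \<inter> \<Inter>\<GG> = (carrier G \<inter> \<Inter>\<GG>') \<inter> card_Inter \<kappa> G \<GG>"
proof (rule ccontr)
  assume no: "\<not> ?thesis"
  obtain P where P: "P \<subseteq> carrier G \<times> \<GG>" and sep_all: "\<forall>x\<in>P. \<forall>y\<in>P. fst x \<in> snd y \<longleftrightarrow> x \<noteq> y"
    and large: "\<not> |P| <o \<kappa>"
    using large_separated_set[OF assms(8) no] by (elim exE conjE) (rule that)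
  note sep = bspec[OF bspec[OF sep_all]]
  interpret group G using assms(4) unfolding type_definable_group_def by (rule conjunct1)
  have \<mu>: "Card_order \<mu>" "infinite (Field \<mu>)" and sat: "saturated L \<mu> C" and model: "is_model L T C"
  proof -
    show "Card_order \<mu>" "saturated L \<mu> C" "is_model L T C"
      using assms(3) by (auto simp: monster_model_def)
    let ?W = "{\<phi> :: ('f, 'r, nat) fm. wf_fm L 0 \<phi>}"
    have "inj (\<lambda>n :: nat. Equ (Free n) (Free n) :: ('f, 'r, nat) fm)" by (auto simp: inj_def)
    then have "infinite (range (\<lambda>n :: nat. Equ (Free n) (Free n) :: ('f, 'r, nat) fm))"
      using finite_imageD by blast
    then have "infinite ?W" by (rule contrapos_nn) (erule finite_subset[rotated], auto)
    moreover have "|?W| \<le>o |Field \<mu>|"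
      using assms(3) ordLess_imp_ordLeq ordIso_symmetric[OF card_of_Field_ordIso] ordLeq_ordIso_trans
      unfolding monster_model_def by metis
    ultimately show "infinite (Field \<mu>)" using card_of_ordLeq_infinite by blast
  qed
  obtain m0 where m0: "m0 \<in> univ C" using model by (auto simp: is_model_def is_structure_def)
  have carP: "fst x \<in> carrier G" and member: "snd x \<in> \<FF>" if "x \<in> P" for x
    using subsetD[OF P that] assms(10) by (auto simp: mem_Times_iff)
  have sub: "subgroup (snd x) G" and inst: "\<exists>c. c ` Y \<subseteq> univ C \<and> snd x = realizations C k p c"
    if "x \<in> P" for x
    using bspec[OF assms(7)[unfolded uniformly_type_definable_subgroups_def] member[OF that]] by simp_all
  have car: "carrier G \<subseteq> tuples C k"
    using assms(4) unfolding type_definable_group_def realizations_def by (elim conjE exE) simp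
  have "\<forall>x\<in>P. \<exists>c p0. c ` Y \<subseteq> univ C \<and> snd x = realizations C k p c \<and> finite p0 \<and> p0 \<subseteq> p \<and>
      (\<forall>g\<in>carrier G. \<forall>a\<in>snd x. \<forall>b\<in>snd x. (\<forall>\<psi>\<in>p0. holds C \<psi> g c) \<longrightarrow> fst x \<noteq> a \<otimes>\<^bsub>G\<^esub> g \<otimes>\<^bsub>G\<^esub> b)"
    (is "\<forall>x\<in>P. ?ex x")
  proof
    fix x assume x: "x \<in> P"
    obtain c where c: "c ` Y \<subseteq> univ C" "snd x = realizations C k p c"
      using inst[OF x] by (elim exE conjE)
    obtain \<phi> where \<phi>: "\<phi> \<in> p" "\<not> holds C \<phi> (fst x) c"
      using sep[OF x x] subsetD[OF car carP[OF x]] c(2) by (auto simp: realizations_def)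
    obtain p0 where p0: "finite p0" "p0 \<subseteq> p"
      and two_sided: "\<forall>g\<in>carrier G. (\<forall>\<psi>\<in>p0. holds C \<psi> g c) \<longrightarrow>
        (\<forall>a\<in>snd x. \<forall>b\<in>snd x. holds C \<phi> (a \<otimes>\<^bsub>G\<^esub> g \<otimes>\<^bsub>G\<^esub> b) c)"
      using subgroup_type_two_sided[OF sat \<mu> assms(4,5,6) c(1) sub[OF x] c(2) \<phi>(1)]
      by (elim exE conjE) (rule that)
    have "fst x \<noteq> a \<otimes>\<^bsub>G\<^esub> g \<otimes>\<^bsub>G\<^esub> b"
      if "g \<in> carrier G" "a \<in> snd x" "b \<in> snd x" "\<forall>\<psi>\<in>p0. holds C \<psi> g c" for g a b
      using two_sided that \<phi>(2) by metis
    then show "?ex x" using c p0 by (intro exI[of _ c] exI[of _ p0]) simp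
  qed
  then obtain c q where all: "\<forall>x\<in>P. c x ` Y \<subseteq> univ C \<and> snd x = realizations C k p (c x) \<and>
      finite (q x) \<and> q x \<subseteq> p \<and>
      (\<forall>g\<in>carrier G. \<forall>a\<in>snd x. \<forall>b\<in>snd x. (\<forall>\<psi>\<in>q x. holds C \<psi> g (c x)) \<longrightarrow>
         fst x \<noteq> a \<otimes>\<^bsub>G\<^esub> g \<otimes>\<^bsub>G\<^esub> b)"
    unfolding bchoice_iff by (elim exE) (rule that)
  have c: "c x ` Y \<subseteq> univ C" "snd x = realizations C k p (c x)" if "x \<in> P" for x
    using bspec[OF all that] by simp_all
  have q: "\<forall>x\<in>P. finite (q x) \<and> q x \<subseteq> p" using all by simp
  have q_two_sided: "fst x \<noteq> a \<otimes>\<^bsub>G\<^esub> g \<otimes>\<^bsub>G\<^esub> b"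
    if "x \<in> P" "g \<in> carrier G" "a \<in> snd x" "b \<in> snd x" "\<forall>\<psi>\<in>q x. holds C \<psi> g (c x)" for x g a b
    using bspec[OF all that(1)] that by simp
  obtain \<Phi> and n :: "'m list \<times> 'm list set \<Rightarrow> nat" and ys where small: "|\<Phi> ` P| <o \<kappa>"
    and all_\<Phi>: "\<forall>x\<in>P. finite (\<Phi> x) \<and> \<Phi> x \<subseteq> fmla L k {..<n x} \<and> ys x ` {..<n x} \<subseteq> Y \<and>
      q x \<subseteq> map_fm (map_sum id (ys x)) ` \<Phi> x \<and> map_fm (map_sum id (ys x)) ` \<Phi> x \<subseteq> p"
    using common_schemes[OF assms(8,9,6) q] by (elim exE conjE) (rule that)
  note \<Phi> = bspec[OF all_\<Phi>]
  obtain \<Phi>0 where "infinite {x \<in> P. \<Phi> x = \<Phi>0}"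
    using infinite_fibre[OF assms(8) small large] by blast
  define J where "J = {x \<in> P. \<Phi> x = \<Phi>0}"
  have J: "infinite J" "J \<subseteq> P" "\<And>x. x \<in> J \<Longrightarrow> \<Phi> x = \<Phi>0"
    using \<open>infinite {x \<in> P. \<Phi> x = \<Phi>0}\<close> by (auto simp: J_def)
  \<comment> \<open>The number \<open>n x\<close> of variables may vary with \<open>x \<in> J\<close>; any single one bounds the variables of \<open>\<Phi>0\<close>.
    Where it exceeds \<open>n x\<close>, the tuple \<open>d x\<close> below is filled up with an arbitrary element \<open>m0\<close>.\<close>
  obtain x0 where x0: "x0 \<in> J" using J(1) by (metis ex_in_conv finite.emptyI)
  define l where "l = n x0"
  have \<Phi>0: "finite \<Phi>0" "\<Phi>0 \<subseteq> fmla L k {..<l}" 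
    using \<Phi>[OF subsetD[OF J(2) x0]] J(3)[OF x0] by (simp_all add: l_def)
  obtain \<chi> where \<chi>: "\<chi> \<in> fmla L k {..<l}"
    "\<And>(M :: ('m, 'f, 'r) fo_structure) a d. holds M \<chi> a d \<longleftrightarrow> (\<forall>\<phi>\<in>\<Phi>0. holds M \<phi> a d)"
    using conjunction_in_fmla[OF \<Phi>0] by blast
  define d where "d x = map (\<lambda>i. if i < n x then c x (ys x i) else m0) [0..<l]" for x
  have d: "d x \<in> tuples C l" if "x \<in> J" for x
  proof -
    have xP: "x \<in> P" using J(2) that by blast
    have "c x (ys x i) \<in> univ C" if "i < n x" for i
      using c(1)[OF xP] \<Phi>[OF xP] that by (simp add: image_subset_iff)
    then show ?thesis using m0 by (auto simp: d_def tuples_def)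
  qed
  have d_holds: "holds C \<chi> h (\<lambda>i. d x ! i) \<longleftrightarrow>
      (\<forall>\<psi>\<in>map_fm (map_sum id (ys x)) ` \<Phi> x. holds C \<psi> h (c x))" if x: "x \<in> J" for x h
  proof -
    have "holds C \<phi> h (\<lambda>i. d x ! i) \<longleftrightarrow> holds C \<phi> h (c x \<circ> ys x)" if "\<phi> \<in> \<Phi>0" for \<phi>
    proof (rule holds_cong)
      have "\<phi> \<in> fmla L k {..<n x}" "\<phi> \<in> fmla L k {..<l}"
        using \<Phi>[OF subsetD[OF J(2) x]] \<Phi>0(2) J(3)[OF x] that by (simp_all add: subset_iff)
      then show "\<phi> \<in> fmla L k ({..<n x} \<inter> {..<l})" by (rule fmla_Int)
    qed (auto simp: d_def)
    then show ?thesis using J(3)[OF x] by (auto simp: \<chi>(2) holds_instance)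
  qed
  obtain \<theta> where "\<theta> \<in> fmla L l {..<k}" "has_IP C l k \<theta>"
  proof (rule bexE[OF has_IP_of_omitted_subsets[OF \<chi>(1) J(1) d]])
    fix s assume s: "finite s" "s \<subseteq> J"
    obtain h where h: "h \<in> carrier G" "\<And>x. x \<in> J - s \<Longrightarrow> h \<in> snd x"
      "\<And>x. x \<in> s \<Longrightarrow> \<exists>a\<in>snd x. \<exists>b\<in>snd x. fst x = a \<otimes>\<^bsub>G\<^esub> h \<otimes>\<^bsub>G\<^esub> b"
    proof -
      have inP: "x \<in> P" if "x \<in> J" for x using J(2) that by blast
      have "\<exists>h\<in>carrier G. (\<forall>x\<in>J - s. h \<in> snd x) \<and>
          (\<forall>x\<in>s. \<exists>a\<in>snd x. \<exists>b\<in>snd x. fst x = a \<otimes>\<^bsub>G\<^esub> h \<otimes>\<^bsub>G\<^esub> b)"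
        by (rule separating_product) (use sub carP sep inP s in auto)
      then show ?thesis using that by (elim bexE conjE) simp
    qed
    have "holds C \<chi> h (\<lambda>i. d x ! i) \<longleftrightarrow> x \<notin> s" if x: "x \<in> J" and xP: "x \<in> P" for x
    proof
      assume "x \<notin> s"
      then have "h \<in> realizations C k p (c x)" using h(2)[of x] c(2)[OF xP] x by simp
      then show "holds C \<chi> h (\<lambda>i. d x ! i)"
        using d_holds[OF x] \<Phi>[OF xP] by (simp add: realizations_def subset_iff)
    next
      assume "holds C \<chi> h (\<lambda>i. d x ! i)"
      then have "\<forall>\<psi>\<in>map_fm (map_sum id (ys x)) ` \<Phi> x. holds C \<psi> h (c x)"
        by (simp only: d_holds[OF x])
      note inst_hold = this
      have "q x \<subseteq> map_fm (map_sum id (ys x)) ` \<Phi> x" using \<Phi>[OF xP] by simp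
      then have "\<forall>\<psi>\<in>q x. holds C \<psi> h (c x)"
        by (intro ballI bspec[OF inst_hold]) (rule subsetD)
      then show "x \<notin> s" using q_two_sided[OF xP h(1)] h(3)[of x] by metis
    qed
    then show "\<exists>h\<in>tuples C k. \<forall>x\<in>J. holds C \<chi> h (\<lambda>i. d x ! i) \<longleftrightarrow> x \<notin> s"
      using h(1) car J(2) by (intro bexI[of _ h]) auto
  qed
  then have "\<exists>(M :: ('m, 'f, 'r) fo_structure) k l \<phi>.
      is_model L T M \<and> \<phi> \<in> fmla L k {..<l} \<and> has_IP M k l \<phi>"
    using model by (intro exI conjI)
  then show False using assms(2) unfolding dependent_def by (rule notE[rotated])
qed

end
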